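(* Let $d$ be a positive integer. Every minimally globally $d$-rigid graph is $\mathcal{R}_{d+1}$-independent.
   Context: All graphs are finite and simple. A framework in $\mathbb{R}^d$ is a pair $(G,p)$ with $G=(V,E)$ a graph and $p:V\to\mathbb{R}^d$; it is generic if the multiset of all coordinates of the points $p(v)$, $v\in V$, is algebraically independent over $\mathbb{Q}$. Two frameworks $(G,p),(G,q)$ are equivalent if $\|p(u)-p(v)\|=\|q(u)-q(v)\|$ for every edge $uv\in E$, and congruent if this holds for every pair $u,v\in V$. A framework is globally rigid if every equivalent framework in $\mathbb{R}^d$ is congruent to it; $G$ is globally $d$-rigid if every generic framework $(G,p)$ in $\mathbb{R}^d$ is globally rigid. $G$ is minimally globally $d$-rigid if it is globally $d$-rigid but $G-e$ is not globally $d$-rigid for every edge $e$. The rigidity matrix $R(G,p)\in\mathbb{R}^{|E|\times d|V|}$ has, in the row of edge $uv$, the vector $p(u)-p(v)$ in the $d$ columns of $u$, $p(v)-p(u)$ in the $d$ columns of $v$, and zeros elsewhere. The $k$-dimensional generic rigidity matroid $\mathcal{R}_k(G)$ is the row matroid of $R(G,p)$ for any generic framework $(G,p)$ in $\mathbb{R}^k$. $G$ is $\mathcal{R}_k$-independent if $E$ is independent in $\mathcal{R}_k(G)$ (i.e. $\mathcal{R}_k(G)$ is free). *)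

theory Defs
  imports "HOL-Analysis.Analysis" "HOL-Library.Poly_Mapping"
begin

section \<open>Algebraic independence over the rationals\<close>

text \<open>A multivariate polynomial with rational coefficients and variables indexed by \<open>'i\<close> is a
  finitely supported map from monomials (finitely supported exponent vectors) to coefficients.\<close>

definition poly_eval :: "('i \<Rightarrow> real) \<Rightarrow> (('i \<Rightarrow>\<^sub>0 nat) \<Rightarrow>\<^sub>0 rat) \<Rightarrow> real" where
  "poly_eval x P =
    (\<Sum>m\<in>Poly_Mapping.keys P. of_rat (Poly_Mapping.lookup P m) *
       (\<Prod>i\<in>Poly_Mapping.keys m. x i ^ Poly_Mapping.lookup m i))"

text \<open>Independence of the family \<open>(x i)\<close>, \<open>i \<in> I\<close>, rather than of the set of its values: a
  repeated value makes the family dependent.\<close>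

definition algebraically_independent :: "('i \<Rightarrow> real) \<Rightarrow> 'i set \<Rightarrow> bool" where
  "algebraically_independent x I \<longleftrightarrow>
    (\<forall>P. (\<forall>m\<in>Poly_Mapping.keys P. Poly_Mapping.keys m \<subseteq> I) \<longrightarrow> poly_eval x P = 0 \<longrightarrow> P = 0)"

section \<open>Graphs and frameworks\<close>

definition simple_graph :: "'a set \<Rightarrow> 'a set set \<Rightarrow> bool" where
  "simple_graph V E \<longleftrightarrow> finite V \<and> (\<forall>e\<in>E. e \<subseteq> V \<and> card e = 2)"

text \<open>The position of vertex \<open>v\<close> in \<open>d\<close>-dimensional space is given by the coordinates \<open>p v i\<close>
  with \<open>i < d\<close>; the values of \<open>p\<close> outside \<open>V \<times> {..<d}\<close> are never used.\<close>

type_synonym 'a placement = "'a \<Rightarrow> nat \<Rightarrow> real"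

definition pdist :: "nat \<Rightarrow> 'a placement \<Rightarrow> 'a \<Rightarrow> 'a \<Rightarrow> real" where
  "pdist d p u v = L2_set (\<lambda>i. p u i - p v i) {..<d}"

definition generic :: "nat \<Rightarrow> 'a set \<Rightarrow> 'a placement \<Rightarrow> bool" where
  "generic d V p \<longleftrightarrow> algebraically_independent (\<lambda>(v, i). p v i) (V \<times> {..<d})"

definition equivalent_frameworks ::
  "nat \<Rightarrow> 'a set set \<Rightarrow> 'a placement \<Rightarrow> 'a placement \<Rightarrow> bool" where
  "equivalent_frameworks d E p q \<longleftrightarrow> (\<forall>u v. {u, v} \<in> E \<longrightarrow> pdist d p u v = pdist d q u v)"

definition congruent_frameworks ::
  "nat \<Rightarrow> 'a set \<Rightarrow> 'a placement \<Rightarrow> 'a placement \<Rightarrow> bool" where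
  "congruent_frameworks d V p q \<longleftrightarrow> (\<forall>u\<in>V. \<forall>v\<in>V. pdist d p u v = pdist d q u v)"

definition globally_rigid_framework ::
  "nat \<Rightarrow> 'a set \<Rightarrow> 'a set set \<Rightarrow> 'a placement \<Rightarrow> bool" where
  "globally_rigid_framework d V E p \<longleftrightarrow>
    (\<forall>q. equivalent_frameworks d E p q \<longrightarrow> congruent_frameworks d V p q)"

definition globally_rigid :: "nat \<Rightarrow> 'a set \<Rightarrow> 'a set set \<Rightarrow> bool" where
  "globally_rigid d V E \<longleftrightarrow> (\<forall>p. generic d V p \<longrightarrow> globally_rigid_framework d V E p)"

definition minimally_globally_rigid :: "nat \<Rightarrow> 'a set \<Rightarrow> 'a set set \<Rightarrow> bool" where
  "minimally_globally_rigid d V E \<longleftrightarrow>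
    globally_rigid d V E \<and> (\<forall>e\<in>E. \<not> globally_rigid d V (E - {e}))"

section \<open>The generic rigidity matroid\<close>

text \<open>Rows are indexed by edges and columns by pairs of a vertex and a coordinate. For \<open>w \<in> e\<close> the
  sum has exactly one term, coming from the other endpoint of \<open>e\<close>.\<close>

definition rigidity_matrix :: "'a placement \<Rightarrow> 'a set \<Rightarrow> 'a \<times> nat \<Rightarrow> real" where
  "rigidity_matrix p e = (\<lambda>(w, i). if w \<in> e then \<Sum>z\<in>e - {w}. p w i - p z i else 0)"

lemma rigidity_matrix_edge:
  assumes "u \<noteq> v"
  shows "rigidity_matrix p {u, v} (w, i) =
    (if w = u then p u i - p v i else if w = v then p v i - p u i else 0)"
proof -
  have "{u, v} - {u} = {v}" "{u, v} - {v} = {u}" using assms by auto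
  then show ?thesis by (auto simp: rigidity_matrix_def)
qed

text \<open>Linear independence of the family \<open>(M e)\<close>, \<open>e \<in> F\<close>, of row vectors with column set \<open>C\<close>;
  equal rows are dependent.\<close>

definition rows_independent :: "('r \<Rightarrow> 'c \<Rightarrow> real) \<Rightarrow> 'c set \<Rightarrow> 'r set \<Rightarrow> bool" where
  "rows_independent M C F \<longleftrightarrow>
    (\<forall>a. (\<forall>c\<in>C. (\<Sum>e\<in>F. a e * M e c) = 0) \<longrightarrow> (\<forall>e\<in>F. a e = 0))"

text \<open>The independent sets of the generic rigidity matroid in dimension \<open>k\<close>, whose ground set is
  \<open>E\<close>. Independence of the rows does not depend on the generic placement, so it is
  required for every one.\<close>

definition rigidity_matroid_indep :: "nat \<Rightarrow> 'a set \<Rightarrow> 'a set set \<Rightarrow> 'a set set \<Rightarrow> bool" where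
  "rigidity_matroid_indep k V E F \<longleftrightarrow>
    F \<subseteq> E \<and> (\<forall>p. generic k V p \<longrightarrow> rows_independent (rigidity_matrix p) (V \<times> {..<k}) F)"

definition rigidity_independent :: "nat \<Rightarrow> 'a set \<Rightarrow> 'a set set \<Rightarrow> bool" where
  "rigidity_independent k V E \<longleftrightarrow> rigidity_matroid_indep k V E E"

end

theory Submission
  imports Defs "HOL-Computational_Algebra.Polynomial"
begin

text \<open>
  Let \<open>e = {u, v}\<close> be an edge with a nonzero coefficient in a stress of a generic framework in
  dimension \<open>d + 1\<close>; clearing denominators, this stress is given by rational polynomials, which
  yield stresses \<open>\<omega>(p, x)\<close> for all placements \<open>(p, x)\<close>. Let \<open>p\<close> be generic in dimension \<open>d\<close> and
  let \<open>q\<close> be equivalent to \<open>p\<close> on \<open>E - {e}\<close>. Every stress of \<open>p\<close> supported on \<open>E - {e}\<close> is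
  also a stress of \<open>q\<close> (Connelly). Normalise \<open>\<omega>(p, x)\<close> to have \<open>e\<close>-coefficient \<open>1\<close>, fix one
  \<open>\<omega> = \<omega>(p, x\<^sub>0)\<close>, and write \<open>\<Omega>\<close>, \<open>\<Omega>\<^sub>x\<close> for the stress matrices. As \<open>\<omega> - \<omega>(p, x)\<close> is
  supported on \<open>E - {e}\<close>, each coordinate vector \<open>q\<^sub>k\<close> of \<open>q\<close> satisfies
  \<open>x\<^sup>T \<Omega> q\<^sub>k = x\<^sup>T \<Omega>\<^sub>x q\<^sub>k = 0\<close>, for all \<open>x\<close> outside a proper algebraic set and so for all \<open>x\<close>,
  in particular for \<open>x = q\<^sub>k\<close>. Hence both \<open>p\<close> and \<open>q\<close> have energy zero with respect to \<open>\<omega>\<close>, and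
  they have the same lengths off \<open>e\<close>, hence the same length at \<open>e\<close>. Thus \<open>p\<close> and \<open>q\<close> are
  equivalent on \<open>E\<close>, and if \<open>E\<close> is globally rigid then so is \<open>E - {e}\<close>.
\<close>

section \<open>Rational polynomial functions\<close>

text \<open>Polynomial functions are generated semantically, so that closure properties follow by
  rule induction; formal polynomials are needed only for the link to
  \<open>algebraically_independent\<close>.\<close>

inductive_set rat_poly_fun :: "'i set \<Rightarrow> (('i \<Rightarrow> real) \<Rightarrow> real) set" for I where
  const: "(\<lambda>x. of_rat c) \<in> rat_poly_fun I"
| var: "i \<in> I \<Longrightarrow> (\<lambda>x. x i) \<in> rat_poly_fun I"
| add: "f \<in> rat_poly_fun I \<Longrightarrow> g \<in> rat_poly_fun I \<Longrightarrow> (\<lambda>x. f x + g x) \<in> rat_poly_fun I"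
| mult: "f \<in> rat_poly_fun I \<Longrightarrow> g \<in> rat_poly_fun I \<Longrightarrow> (\<lambda>x. f x * g x) \<in> rat_poly_fun I"

lemma rat_poly_fun_of_int: "(\<lambda>x. of_int c) \<in> rat_poly_fun I"
  using rat_poly_fun.const[of "of_int c" I] by simp

lemma rat_poly_fun_diff:
  assumes "f \<in> rat_poly_fun I" "g \<in> rat_poly_fun I"
  shows "(\<lambda>x. f x - g x) \<in> rat_poly_fun I"
  using rat_poly_fun.add[OF assms(1) rat_poly_fun.mult[OF rat_poly_fun_of_int[of "-1"] assms(2)]]
  by simp

lemma rat_poly_fun_sum:
  assumes "\<And>a. a \<in> A \<Longrightarrow> f a \<in> rat_poly_fun I"
  shows "(\<lambda>x. \<Sum>a\<in>A. f a x) \<in> rat_poly_fun I"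
  using assms
proof (induction A rule: infinite_finite_induct)
  case (insert a A)
  then show ?case using rat_poly_fun.add[of "f a" I "\<lambda>x. \<Sum>a\<in>A. f a x"] by simp
qed (use rat_poly_fun_of_int[of 0 I] in simp_all)

text \<open>Restriction to a line reduces questions about zeros in many variables to roots of a real
  polynomial in one variable.\<close>

lemma rat_poly_fun_along_line:
  assumes "f \<in> rat_poly_fun I"
  shows "\<exists>\<pi> :: real poly. \<forall>s. f (\<lambda>i. x i + s * v i) = poly \<pi> s"
  using assms
proof induction
  case (const c)
  show ?case by (rule exI[of _ "[:of_rat c:]"]) simp
next
  case (var i)
  show ?case by (rule exI[of _ "[:x i, v i:]"]) simp
next
  case (add f g)
  then obtain \<pi> \<rho> :: "real poly" where "\<forall>s. f (\<lambda>i. x i + s * v i) = poly \<pi> s"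
    "\<forall>s. g (\<lambda>i. x i + s * v i) = poly \<rho> s" by blast
  then show ?case by (intro exI[of _ "\<pi> + \<rho>"]) simp
next
  case (mult f g)
  then obtain \<pi> \<rho> :: "real poly" where "\<forall>s. f (\<lambda>i. x i + s * v i) = poly \<pi> s"
    "\<forall>s. g (\<lambda>i. x i + s * v i) = poly \<rho> s" by blast
  then show ?case by (intro exI[of _ "\<pi> * \<rho>"]) simp
qed

lemma rat_poly_fun_tendsto:
  assumes "f \<in> rat_poly_fun I" "\<And>i. i \<in> I \<Longrightarrow> (\<lambda>n. y n i) \<longlonglongrightarrow> x i"
  shows "(\<lambda>n. f (y n)) \<longlonglongrightarrow> f x"
  using assms by induction (auto intro: tendsto_intros)

lemma rat_poly_fun_subst:
  assumes "f \<in> rat_poly_fun I" "\<And>i. i \<in> I \<Longrightarrow> (\<lambda>x. h x i) \<in> rat_poly_fun J"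
  shows "(\<lambda>x. f (h x)) \<in> rat_poly_fun J"
  using assms by induction (auto intro: rat_poly_fun.intros)

section \<open>Evaluation of formal polynomials as a ring homomorphism\<close>

definition monom_eval :: "('i \<Rightarrow> real) \<Rightarrow> ('i \<Rightarrow>\<^sub>0 nat) \<Rightarrow> real" where
  "monom_eval x m = (\<Prod>i\<in>Poly_Mapping.keys m. x i ^ Poly_Mapping.lookup m i)"

lemma monom_eval_superset:
  assumes "finite A" "Poly_Mapping.keys m \<subseteq> A"
  shows "monom_eval x m = (\<Prod>i\<in>A. x i ^ Poly_Mapping.lookup m i)"
  unfolding monom_eval_def using assms
  by (intro prod.mono_neutral_left) (auto simp: in_keys_iff)

lemma monom_eval_add: "monom_eval x (m + n) = monom_eval x m * monom_eval x n"
proof -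
  let ?A = "Poly_Mapping.keys m \<union> Poly_Mapping.keys n"
  have "monom_eval x k = (\<Prod>i\<in>?A. x i ^ Poly_Mapping.lookup k i)" if "k \<in> {m, n, m + n}" for k
    using that Poly_Mapping.keys_add[of m n] by (intro monom_eval_superset) auto
  then show ?thesis by (simp add: lookup_add power_add prod.distrib)
qed

lemma poly_eval_superset:
  assumes "finite A" "Poly_Mapping.keys P \<subseteq> A"
  shows "poly_eval x P = (\<Sum>m\<in>A. of_rat (Poly_Mapping.lookup P m) * monom_eval x m)"
  unfolding poly_eval_def monom_eval_def[symmetric] using assms
  by (intro sum.mono_neutral_left) (auto simp: in_keys_iff)

lemma poly_eval_zero: "poly_eval x 0 = 0"
  by (simp add: poly_eval_def)

lemma poly_eval_add: "poly_eval x (P + Q) = poly_eval x P + poly_eval x Q"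
proof -
  let ?A = "Poly_Mapping.keys P \<union> Poly_Mapping.keys Q"
  have "poly_eval x R = (\<Sum>m\<in>?A. of_rat (Poly_Mapping.lookup R m) * monom_eval x m)"
    if "R \<in> {P, Q, P + Q}" for R
    using that Poly_Mapping.keys_add[of P Q] by (intro poly_eval_superset) auto
  then show ?thesis by (simp add: lookup_add of_rat_add distrib_right sum.distrib)
qed

lemma poly_eval_sum: "poly_eval x (\<Sum>a\<in>A. P a) = (\<Sum>a\<in>A. poly_eval x (P a))"
  by (induction A rule: infinite_finite_induct) (auto simp: poly_eval_zero poly_eval_add)

lemma poly_eval_single: "poly_eval x (Poly_Mapping.single m c) = of_rat c * monom_eval x m"
  by (subst poly_eval_superset[of "{m}"]) auto

lemma poly_mapping_eq_sum_single:
  "P = (\<Sum>m\<in>Poly_Mapping.keys P. Poly_Mapping.single m (Poly_Mapping.lookup P m))"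
  by (rule poly_mapping_eqI)
     (auto simp: lookup_sum lookup_single when_def in_keys_iff)

lemma poly_eval_mult: "poly_eval x (P * Q) = poly_eval x P * poly_eval x Q"
proof -
  let ?t = "\<lambda>P m. Poly_Mapping.single m (Poly_Mapping.lookup P m)"
  have "P * Q = (\<Sum>m\<in>Poly_Mapping.keys P. ?t P m) * (\<Sum>n\<in>Poly_Mapping.keys Q. ?t Q n)"
    by (simp flip: poly_mapping_eq_sum_single)
  also have "\<dots> = (\<Sum>m\<in>Poly_Mapping.keys P. \<Sum>n\<in>Poly_Mapping.keys Q. ?t P m * ?t Q n)"
    by (rule sum_product)
  finally have "poly_eval x (P * Q) =
      (\<Sum>m\<in>Poly_Mapping.keys P. \<Sum>n\<in>Poly_Mapping.keys Q. poly_eval x (?t P m * ?t Q n))"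
    by (simp only: poly_eval_sum)
  also have "\<dots> = (\<Sum>m\<in>Poly_Mapping.keys P. \<Sum>n\<in>Poly_Mapping.keys Q.
      (of_rat (Poly_Mapping.lookup P m) * monom_eval x m) *
      (of_rat (Poly_Mapping.lookup Q n) * monom_eval x n))"
    by (simp add: mult_single poly_eval_single monom_eval_add of_rat_mult mult.assoc
        mult.left_commute[of "monom_eval _ _"])
  also have "\<dots> = poly_eval x P * poly_eval x Q"
    by (simp only: poly_eval_def sum_product flip: monom_eval_def)
  finally show ?thesis .
qed

lemma rat_poly_fun_poly_eval:
  assumes "f \<in> rat_poly_fun I"
  shows "\<exists>P. (\<forall>m\<in>Poly_Mapping.keys P. Poly_Mapping.keys m \<subseteq> I) \<and> (\<forall>x. f x = poly_eval x P)"
  using assms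
proof induction
  case (const c)
  show ?case by (rule exI[of _ "Poly_Mapping.single 0 c"])
    (simp add: poly_eval_single monom_eval_def)
next
  case (var i)
  then show ?case by (intro exI[of _ "Poly_Mapping.single (Poly_Mapping.single i 1) 1"])
    (simp add: poly_eval_single monom_eval_def)
next
  case (add f g)
  then obtain P Q where PQ:
    "\<forall>m\<in>Poly_Mapping.keys P. Poly_Mapping.keys m \<subseteq> I" "\<forall>x. f x = poly_eval x P"
    "\<forall>m\<in>Poly_Mapping.keys Q. Poly_Mapping.keys m \<subseteq> I" "\<forall>x. g x = poly_eval x Q" by blast
  have "Poly_Mapping.keys m \<subseteq> I" if "m \<in> Poly_Mapping.keys (P + Q)" for m
    using that PQ(1,3) Poly_Mapping.keys_add[of P Q] by blast
  then show ?case using PQ(2,4) by (intro exI[of _ "P + Q"]) (auto simp: poly_eval_add)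
next
  case (mult f g)
  then obtain P Q where PQ:
    "\<forall>m\<in>Poly_Mapping.keys P. Poly_Mapping.keys m \<subseteq> I" "\<forall>x. f x = poly_eval x P"
    "\<forall>m\<in>Poly_Mapping.keys Q. Poly_Mapping.keys m \<subseteq> I" "\<forall>x. g x = poly_eval x Q" by blast
  have "Poly_Mapping.keys m \<subseteq> I" if m: "m \<in> Poly_Mapping.keys (P * Q)" for m
  proof -
    obtain a b where "m = a + b" "a \<in> Poly_Mapping.keys P" "b \<in> Poly_Mapping.keys Q"
      using subsetD[OF keys_mult m] by blast
    then show ?thesis using PQ(1,3) Poly_Mapping.keys_add[of a b] by blast
  qed
  then show ?case using PQ(2,4) by (intro exI[of _ "P * Q"]) (auto simp: poly_eval_mult)
qed

text \<open>All uses of genericity pass through this fact: the formal polynomial behind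
  \<open>f\<close> vanishes at the independent family \<open>x\<close>, so it is the zero
  polynomial.\<close>

lemma rat_poly_fun_vanishes:
  assumes "algebraically_independent x I" "f \<in> rat_poly_fun I" "f x = 0"
  shows "f y = 0"
proof -
  obtain P where P: "\<forall>m\<in>Poly_Mapping.keys P. Poly_Mapping.keys m \<subseteq> I" "\<And>x. f x = poly_eval x P"
    using rat_poly_fun_poly_eval[OF assms(2)] by blast
  have "P = 0"
    using assms(1,3) P unfolding algebraically_independent_def by metis
  then show ?thesis using P(2) by (simp add: poly_eval_zero)
qed

section \<open>Linear relations between rows\<close>

text \<open>A failure of \<open>rows_independent\<close> is a relation that is nonzero somewhere on
  \<open>F\<close>. For the rigidity matrix the relations are the equilibrium stresses.\<close>

definition row_relation ::
    "('r \<Rightarrow> 'c \<Rightarrow> real) \<Rightarrow> 'c set \<Rightarrow> 'r set \<Rightarrow> ('r \<Rightarrow> real) \<Rightarrow> bool" where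
  "row_relation M C F a \<longleftrightarrow> (\<forall>c\<in>C. (\<Sum>e\<in>F. a e * M e c) = 0)"

lemma row_relation_diff_scale:
  assumes "row_relation M C F a" "row_relation M C F b"
  shows "row_relation M C F (\<lambda>e. a e - t * b e)"
  using assms unfolding row_relation_def
  by (simp add: left_diff_distrib sum_subtractf mult.assoc flip: sum_distrib_left)

lemma row_relation_add_scale:
  assumes "row_relation M C F a" "row_relation M C F b"
  shows "row_relation M C F (\<lambda>e. a e + t * b e)"
  using row_relation_diff_scale[OF assms, of "- t"] by simp

lemma row_relation_scale:
  assumes "row_relation M C F a"
  shows "row_relation M C F (\<lambda>e. t * a e)"
  using assms unfolding row_relation_def
  by (simp add: mult.assoc flip: sum_distrib_left)

lemma row_relation_delete:
  assumes "finite F" "a g = 0"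
  shows "row_relation M C F a \<longleftrightarrow> row_relation M C (F - {g}) a"
proof -
  have "(\<Sum>e\<in>F. a e * M e c) = (\<Sum>e\<in>F - {g}. a e * M e c)" for c
    using assms by (intro sum.mono_neutral_right) auto
  then show ?thesis unfolding row_relation_def by simp
qed

text \<open>Row \<open>b\<close> clears column \<open>c\<close> without division: the new entries
  are 2 by 2 minors. The coefficients stay the same because the new row \<open>b\<close> is
  zero.\<close>

lemma row_relation_minor:
  assumes "row_relation M C F a" "finite F" "b \<in> F" "c \<in> C" "C' \<subseteq> C"
  shows "row_relation (\<lambda>e j. M b c * M e j - M e c * M b j) C' (F - {b}) a"
  unfolding row_relation_def
proof
  fix j assume j: "j \<in> C'"
  have "(\<Sum>e\<in>F - {b}. a e * (M b c * M e j - M e c * M b j)) =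
      (\<Sum>e\<in>F. a e * (M b c * M e j - M e c * M b j))"
    using assms(2,3) by (intro sum.mono_neutral_left) auto
  also have "\<dots> = M b c * (\<Sum>e\<in>F. a e * M e j) - (\<Sum>e\<in>F. a e * M e c) * M b j"
    by (simp add: sum_distrib_left sum_distrib_right right_diff_distrib sum_subtractf ac_simps)
  also have "\<dots> = 0" using assms(1,4,5) j unfolding row_relation_def by auto
  finally show "(\<Sum>e\<in>F - {b}. a e * (M b c * M e j - M e c * M b j)) = 0" .
qed

text \<open>Fraction-free Gaussian elimination, one column at a time.\<close>

lemma polynomial_row_relation:
  fixes M :: "('i \<Rightarrow> real) \<Rightarrow> 'r \<Rightarrow> 'c \<Rightarrow> real"
  assumes "algebraically_independent x I"
    and "finite C" "finite F" "g \<in> F"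
    and "\<And>e c. e \<in> F \<Longrightarrow> c \<in> C \<Longrightarrow> (\<lambda>y. M y e c) \<in> rat_poly_fun I"
    and "row_relation (M x) C F a" "a g \<noteq> 0"
  shows "\<exists>P. (\<forall>e\<in>F. P e \<in> rat_poly_fun I) \<and> P g x \<noteq> 0 \<and>
    (\<forall>y. row_relation (M y) C F (\<lambda>e. P e y))"
  using assms(2-)
proof (induction C arbitrary: F M rule: finite_induct)
  case empty
  show ?case
    by (rule exI[of _ "\<lambda>_ _. 1"])
       (use rat_poly_fun_of_int[of 1 I] in \<open>simp add: row_relation_def\<close>)
next
  case (insert c C)
  show ?case
  \<comment> \<open>The pivot row is never \<open>g\<close>, so the coefficient of \<open>g\<close>,
    nonzero at \<open>x\<close>, survives every elimination.\<close>
  proof (cases "\<exists>b\<in>F - {g}. M x b c \<noteq> 0")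
    case True
    then obtain b where b: "b \<in> F" "b \<noteq> g" "M x b c \<noteq> 0" by blast
    define N where "N = (\<lambda>y e j. M y b c * M y e j - M y e c * M y b j)"
    have "row_relation (N x) C (F - {b}) a"
      unfolding N_def using row_relation_minor[OF insert.prems(4,1) b(1), of c C] by auto
    moreover have "(\<lambda>y. N y e j) \<in> rat_poly_fun I" if "e \<in> F - {b}" "j \<in> C" for e j
      unfolding N_def using that b(1) insert.prems(3)
      by (intro rat_poly_fun_diff rat_poly_fun.mult) auto
    ultimately have "\<exists>P. (\<forall>e\<in>F - {b}. P e \<in> rat_poly_fun I) \<and> P g x \<noteq> 0 \<and>
        (\<forall>y. row_relation (N y) C (F - {b}) (\<lambda>e. P e y))"
      using insert.prems(1,2,5) b by (intro insert.IH) auto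
    then obtain P where P: "\<And>e. e \<in> F - {b} \<Longrightarrow> P e \<in> rat_poly_fun I" "P g x \<noteq> 0"
      "\<And>y. row_relation (N y) C (F - {b}) (\<lambda>e. P e y)"
      by blast
    \<comment> \<open>Back substitution: the coefficients found are scaled by the pivot, and that of
      \<open>b\<close> is chosen to cancel column \<open>c\<close>.\<close>
    define Q where "Q = (\<lambda>e y. if e = b then 0 - (\<Sum>e\<in>F - {b}. P e y * M y e c)
      else M y b c * P e y)"
    have Q: "Q e \<in> rat_poly_fun I" if "e \<in> F" for e
    proof (cases "e = b")
      case True
      then have "Q e = (\<lambda>y. real_of_int 0 - (\<Sum>e\<in>F - {b}. P e y * M y e c))"
        by (auto simp: Q_def)
      also have "\<dots> \<in> rat_poly_fun I" using P(1) insert.prems(3)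
        by (intro rat_poly_fun_diff rat_poly_fun_sum rat_poly_fun.mult rat_poly_fun_of_int) auto
      finally show ?thesis .
    next
      case False
      then have "Q e = (\<lambda>y. M y b c * P e y)" by (auto simp: Q_def)
      then show ?thesis using rat_poly_fun.mult[of "\<lambda>y. M y b c" I "P e"]
          that b False P(1) insert.prems(3) by auto
    qed
    have rel: "(\<Sum>e\<in>F. Q e y * M y e j) = (\<Sum>e\<in>F - {b}. P e y * N y e j)" for y j
    proof -
      have "(\<Sum>e\<in>F. Q e y * M y e j) = Q b y * M y b j + (\<Sum>e\<in>F - {b}. Q e y * M y e j)"
        using insert.prems(1) b(1) by (rule sum.remove)
      also have "(\<Sum>e\<in>F - {b}. Q e y * M y e j) = (\<Sum>e\<in>F - {b}. M y b c * P e y * M y e j)"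
        by (rule sum.cong) (auto simp: Q_def)
      also have "Q b y * M y b j = - (\<Sum>e\<in>F - {b}. P e y * M y e c * M y b j)"
        by (simp add: Q_def sum_distrib_right)
      finally show ?thesis
        by (simp add: N_def right_diff_distrib sum_subtractf algebra_simps)
    qed
    have "row_relation (M y) (insert c C) F (\<lambda>e. Q e y)" for y
      using P(3)[of y] unfolding row_relation_def rel by (auto simp: N_def)
    moreover have "Q g x \<noteq> 0" using P(2) b by (simp add: Q_def)
    ultimately show ?thesis using Q by blast
  next
    case False
    \<comment> \<open>Without a pivot only the term of \<open>g\<close> is left in column
      \<open>c\<close>, so the whole column vanishes at \<open>x\<close> and, by genericity,
      identically.\<close>
    have "(\<Sum>e\<in>F. a e * M x e c) = a g * M x g c"
      using False insert.prems(1,2) by (subst sum.remove[of _ g]) auto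
    then have "M x g c = 0"
      using insert.prems(4,5) by (simp add: row_relation_def)
    then have 0: "M y e c = 0" if "e \<in> F" for e y
      using rat_poly_fun_vanishes[OF assms(1) insert.prems(3)[OF that, of c]] that False by auto
    have "\<exists>P. (\<forall>e\<in>F. P e \<in> rat_poly_fun I) \<and> P g x \<noteq> 0 \<and>
        (\<forall>y. row_relation (M y) C F (\<lambda>e. P e y))"
      using insert.prems by (intro insert.IH) (auto simp: row_relation_def)
    then show ?thesis using 0 unfolding row_relation_def by auto
  qed
qed

text \<open>The relation is divided by powers of the parameter until it no longer vanishes at \<open>0\<close>.\<close>

lemma row_relation_specialize:
  fixes M :: "'r \<Rightarrow> 'c \<Rightarrow> real poly"
  assumes "g \<in> F" "a g \<noteq> 0" "\<And>c. c \<in> C \<Longrightarrow> (\<Sum>e\<in>F. a e * M e c) = 0"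
  shows "\<exists>b. row_relation (\<lambda>e c. poly (M e c) 0) C F b \<and> (\<exists>e\<in>F. b e \<noteq> 0)"
  using assms(2,3)
proof (induction "degree (a g)" arbitrary: a rule: less_induct)
  case less
  show ?case
  proof (cases "\<exists>e\<in>F. poly (a e) 0 \<noteq> 0")
    case True
    have "(\<Sum>e\<in>F. poly (a e) 0 * poly (M e c) 0) = 0" if "c \<in> C" for c
      using arg_cong[OF less.prems(2)[OF that], of "\<lambda>p. poly p 0"] by (simp add: poly_sum)
    then show ?thesis using True
      by (intro exI[of _ "\<lambda>e. poly (a e) 0"]) (auto simp: row_relation_def)
  next
    case False
    then have "\<exists>q. a e = [:0, 1:] * q" if "e \<in> F" for e
      using that by (auto simp: poly_eq_0_iff_dvd dvd_def)
    then obtain b where b: "\<And>e. e \<in> F \<Longrightarrow> a e = [:0, 1:] * b e" by metis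
    have bg: "b g \<noteq> 0" using b[OF assms(1)] less.prems(1) by auto
    have "degree (b g) < degree (a g)"
      using b[OF assms(1)] bg by (simp add: degree_mult_eq)
    moreover have "(\<Sum>e\<in>F. b e * M e c) = 0" if "c \<in> C" for c
    proof -
      have "[:0, 1:] * (\<Sum>e\<in>F. b e * M e c) = (\<Sum>e\<in>F. a e * M e c)"
        unfolding sum_distrib_left by (rule sum.cong) (auto simp only: b mult.assoc)
      then show ?thesis using less.prems(2)[OF that] by simp
    qed
    ultimately show ?thesis using less.hyps bg by blast
  qed
qed

text \<open>The polynomial coefficients of a relation may all vanish at \<open>y\<close>. Along the
  line from \<open>y\<close> to \<open>x\<close> they become one-variable polynomials, whose common
  power of the parameter is removed before the parameter is set to 0.\<close>

lemma row_relation_transfer: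
  fixes M :: "('i \<Rightarrow> real) \<Rightarrow> 'r \<Rightarrow> 'c \<Rightarrow> real"
  assumes "algebraically_independent x I"
    and "finite C" "finite F" "g \<in> F"
    and M: "\<And>e c. e \<in> F \<Longrightarrow> c \<in> C \<Longrightarrow> (\<lambda>y. M y e c) \<in> rat_poly_fun I"
    and "row_relation (M x) C F a" "a g \<noteq> 0"
  shows "\<exists>b. row_relation (M y) C F b \<and> (\<exists>e\<in>F. b e \<noteq> 0)"
proof -
  obtain P where P: "\<And>e. e \<in> F \<Longrightarrow> P e \<in> rat_poly_fun I" "P g x \<noteq> 0"
      "\<And>y. row_relation (M y) C F (\<lambda>e. P e y)"
    using polynomial_row_relation[OF assms] by blast
  define l where "l = (\<lambda>s i. y i + s * (x i - y i))"
  have "\<forall>e\<in>F. \<exists>\<pi> :: real poly. \<forall>s. P e (l s) = poly \<pi> s"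
    unfolding l_def by (intro ballI rat_poly_fun_along_line[of _ I] P(1))
  then obtain \<pi> :: "_ \<Rightarrow> real poly" where \<pi>: "\<And>e s. e \<in> F \<Longrightarrow> P e (l s) = poly (\<pi> e) s"
    by (auto dest!: bchoice)
  have "\<forall>ec\<in>F \<times> C. \<exists>\<pi> :: real poly. \<forall>s. M (l s) (fst ec) (snd ec) = poly \<pi> s"
    using rat_poly_fun_along_line[OF M] unfolding l_def by auto
  from bchoice[OF this] obtain \<mu>' :: "_ \<Rightarrow> real poly" where
    \<mu>': "\<forall>ec\<in>F \<times> C. \<forall>s. M (l s) (fst ec) (snd ec) = poly (\<mu>' ec) s" ..
  define \<mu> where "\<mu> = (\<lambda>e c. \<mu>' (e, c))"
  have \<mu>: "M (l s) e c = poly (\<mu> e c) s" if "e \<in> F" "c \<in> C" for e c s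
    using \<mu>' that by (auto simp: \<mu>_def)
  have l: "l 1 = x" "l 0 = y" by (auto simp: l_def)
  have "\<pi> g \<noteq> 0" using \<pi>[OF assms(4), of 1] P(2) l by auto
  moreover have "(\<Sum>e\<in>F. \<pi> e * \<mu> e c) = 0" if "c \<in> C" for c
  proof -
    have "poly (\<Sum>e\<in>F. \<pi> e * \<mu> e c) s = 0" for s
      using P(3)[of "l s"] that \<pi> \<mu> by (simp add: row_relation_def poly_sum)
    then show ?thesis using poly_all_0_iff_0 by blast
  qed
  ultimately obtain b where "row_relation (\<lambda>e c. poly (\<mu> e c) 0) C F b" "\<exists>e\<in>F. b e \<noteq> 0"
    using row_relation_specialize[OF assms(4), of \<pi> C \<mu>] by blast
  moreover have "M y e c = poly (\<mu> e c) 0" if "e \<in> F" "c \<in> C" for e c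
    using \<mu>[OF that, of 0] l by simp
  ultimately show ?thesis unfolding row_relation_def by (intro exI[of _ b]) auto
qed

section \<open>Extending derivations\<close>

text \<open>The graph of a derivation from a subring of the reals to the reals is a subring of the dual
  numbers \<open>a + b \<epsilon>\<close>, \<open>\<epsilon>\<^sup>2 = 0\<close>, that is single-valued.\<close>

locale derivation_graph =
  fixes G :: "(real \<times> real) set"
  assumes minus_one: "(-1, 0) \<in> G"
    and add: "(a, a') \<in> G \<Longrightarrow> (b, b') \<in> G \<Longrightarrow> (a + b, a' + b') \<in> G"
    and mult: "(a, a') \<in> G \<Longrightarrow> (b, b') \<in> G \<Longrightarrow> (a * b, a' * b + a * b') \<in> G"
    and single_valued: "(0, b) \<in> G \<Longrightarrow> b = 0"
begin

lemma one: "(1, 0) \<in> G"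
  using mult[OF minus_one minus_one] by simp

lemma zero: "(0, 0) \<in> G"
  using add[OF minus_one one] by simp

lemma diff:
  assumes "(a, a') \<in> G" "(b, b') \<in> G"
  shows "(a - b, a' - b') \<in> G"
  using add[OF assms(1) mult[OF minus_one assms(2)]] by simp

lemma unique:
  assumes "(a, a') \<in> G" "(a, b') \<in> G"
  shows "a' = b'"
  using single_valued[of "a' - b'"] diff[OF assms] by simp

lemma sum:
  assumes "\<And>i. i \<in> A \<Longrightarrow> (f i, f' i) \<in> G"
  shows "(\<Sum>i\<in>A. f i, \<Sum>i\<in>A. f' i) \<in> G"
  using assms by (induction A rule: infinite_finite_induct) (auto intro: zero add)

lemma of_nat_mult:
  assumes "(a, a') \<in> G"
  shows "(of_nat n * a, of_nat n * a') \<in> G"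
  using sum[of "{..<n}" "\<lambda>_. a" "\<lambda>_. a'"] assms by simp

section \<open>Polynomials over the subring, with the derivation applied to their
  coefficients\<close>

definition coeffs_related :: "real poly \<Rightarrow> real poly \<Rightarrow> bool" where
  "coeffs_related h h' \<longleftrightarrow> (\<forall>i. (coeff h i, coeff h' i) \<in> G)"

lemma coeffs_related_monom: "(a, a') \<in> G \<Longrightarrow> coeffs_related (monom a n) (monom a' n)"
  by (auto simp: coeffs_related_def coeff_monom zero)

lemma coeffs_related_add:
  "coeffs_related g g' \<Longrightarrow> coeffs_related h h' \<Longrightarrow> coeffs_related (g + h) (g' + h')"
  by (auto simp: coeffs_related_def add)

lemma coeffs_related_diff:
  "coeffs_related g g' \<Longrightarrow> coeffs_related h h' \<Longrightarrow> coeffs_related (g - h) (g' - h')"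
  by (auto simp: coeffs_related_def diff)

lemma coeffs_related_mult:
  assumes "coeffs_related g g'" "coeffs_related h h'"
  shows "coeffs_related (g * h) (g' * h + g * h')"
  unfolding coeffs_related_def
proof
  fix n
  have "(\<Sum>i\<le>n. coeff g i * coeff h (n - i),
      \<Sum>i\<le>n. coeff g' i * coeff h (n - i) + coeff g i * coeff h' (n - i)) \<in> G"
    using assms unfolding coeffs_related_def by (intro sum mult) auto
  then show "(coeff (g * h) n, coeff (g' * h + g * h') n) \<in> G"
    by (simp add: coeff_mult sum.distrib)
qed

lemma coeffs_related_pderiv:
  "coeffs_related h h' \<Longrightarrow> coeffs_related (pderiv h) (pderiv h')"
  unfolding coeffs_related_def coeff_pderiv by (intro allI of_nat_mult) auto

lemma coeffs_related_zero: "coeffs_related 0 h' \<Longrightarrow> h' = 0"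
  by (rule poly_eqI) (auto simp: coeffs_related_def dest: single_valued)

text \<open>If \<open>t\<close> is algebraic, its derivative is forced by a relation \<open>\<mu>\<close> of minimal degree; every
  other relation is compatible with it, by pseudo-division by \<open>\<mu>\<close>.\<close>

lemma compatible_derivative:
  "\<exists>t'. \<forall>h h'. coeffs_related h h' \<longrightarrow> poly h t = 0 \<longrightarrow> poly h' t + poly (pderiv h) t * t' = 0"
proof (cases "\<exists>h h'. coeffs_related h h' \<and> h \<noteq> 0 \<and> poly h t = 0")
  case False
  \<comment> \<open>Here \<open>t\<close> is transcendental over the subring: only
    \<open>h = 0\<close> is to be checked, and the derivative 0 is chosen.\<close>
  then show ?thesis using coeffs_related_zero by (intro exI[of _ 0]) auto
next
  case True
  define R where "R = (\<lambda>h. (\<exists>h'. coeffs_related h h') \<and> h \<noteq> 0 \<and> poly h t = 0)"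
  obtain h\<^sub>0 where "R h\<^sub>0" using True unfolding R_def by blast
  then obtain \<mu> where \<mu>: "R \<mu>" "\<And>h. R h \<Longrightarrow> degree \<mu> \<le> degree h"
    using ex_has_least_nat[of R h\<^sub>0 degree] by blast
  obtain \<mu>' where \<mu>': "coeffs_related \<mu> \<mu>'" using \<mu>(1) by (auto simp: R_def)
  have deg: "degree \<mu> > 0"
    using \<mu>(1) by (auto simp: R_def elim!: degree_eq_zeroE intro!: gr0I)
  \<comment> \<open>Separability in characteristic 0: otherwise the derivative of
    \<open>\<mu>\<close> would be a nonzero relation of smaller degree.\<close>
  have nz: "poly (pderiv \<mu>) t \<noteq> 0"
  proof
    assume "poly (pderiv \<mu>) t = 0"
    then have "R (pderiv \<mu>)"
      using coeffs_related_pderiv[OF \<mu>'] deg by (auto simp: R_def pderiv_eq_0_iff)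
    then show False using \<mu>(2)[of "pderiv \<mu>"] deg by (simp add: degree_pderiv)
  qed
  define t' where "t' = - poly \<mu>' t / poly (pderiv \<mu>) t"
  have \<mu>0: "poly \<mu>' t + poly (pderiv \<mu>) t * t' = 0" "poly \<mu> t = 0"
    using nz \<mu>(1) by (auto simp: t'_def R_def)
  have "poly h' t + poly (pderiv h) t * t' = 0" if "coeffs_related h h'" "poly h t = 0" for h h'
    using that
  proof (induction "degree h" arbitrary: h h' rule: less_induct)
    case less
    show ?case
    proof (cases "h = 0")
      case True
      then show ?thesis using less.prems coeffs_related_zero[of h'] by auto
    next
      case False
      then have le: "degree \<mu> \<le> degree h" using less.prems by (intro \<mu>(2)) (auto simp: R_def)
      define a a' c c' k where "a = lead_coeff h" "a' = coeff h' (degree h)"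
        "c = lead_coeff \<mu>" "c' = coeff \<mu>' (degree \<mu>)" "k = degree h - degree \<mu>"
      note defs = this
      have aG: "(a, a') \<in> G" "(c, c') \<in> G"
        using less.prems \<mu>' by (auto simp: defs coeffs_related_def)
      \<comment> \<open>One step of pseudo-division: the leading terms cancel, and \<open>g'\<close>
        follows \<open>g\<close> by the product rule.\<close>
      define g where "g = monom c 0 * h - monom a k * \<mu>"
      define g' where "g' = (monom c' 0 * h + monom c 0 * h') - (monom a' k * \<mu> + monom a k * \<mu>')"
      have g: "coeffs_related g g'"
        unfolding g_def g'_def using aG less.prems(1) \<mu>'
        by (intro coeffs_related_diff coeffs_related_mult coeffs_related_monom)
      have g0: "poly g t = 0" using less.prems(2) \<mu>0 by (simp add: g_def)
      have "c \<noteq> 0" "a \<noteq> 0" using False \<mu>(1) by (auto simp: defs R_def)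
      have "degree g < degree h"
      proof (rule degree_lessI)
        show "g \<noteq> 0 \<or> degree h > 0" using deg le by auto
        show "\<forall>k\<ge>degree h. coeff g k = 0"
        proof (intro allI impI)
          fix j assume j: "degree h \<le> j"
          show "coeff g j = 0"
          proof (cases "j = degree h")
            case True
            then show ?thesis using le
              by (simp add: g_def monom_0 coeff_monom_mult defs)
          next
            case False
            then have "coeff h j = 0" "coeff \<mu> (j - k) = 0"
              using j le by (auto intro!: coeff_eq_0 simp: defs)
            then show ?thesis by (simp add: g_def monom_0 coeff_monom_mult)
          qed
        qed
      qed
      then have "poly g' t + poly (pderiv g) t * t' = 0" using less.hyps g g0 by blast
      \<comment> \<open>All other terms of the product rule carry a factor \<open>poly h t\<close>
        or \<open>poly \<mu> t\<close>, both of which are zero.\<close>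
      moreover have "poly g' t + poly (pderiv g) t * t' =
          c * (poly h' t + poly (pderiv h) t * t') -
          poly (monom a k) t * (poly \<mu>' t + poly (pderiv \<mu>) t * t')"
        using less.prems(2) \<mu>0(2)
        by (simp add: g_def g'_def pderiv_diff pderiv_mult pderiv_smult monom_0 algebra_simps)
      ultimately show ?thesis using \<mu>0(1) \<open>c \<noteq> 0\<close> by simp
    qed
  qed
  then show ?thesis by blast
qed

text \<open>The new domain consists of the values at \<open>t\<close> of polynomials over the old
  one, differentiated by the chain rule. Compatibility of \<open>t'\<close> is exactly
  single-valuedness.\<close>

lemma adjoin: "\<exists>H t'. derivation_graph H \<and> G \<subseteq> H \<and> (t, t') \<in> H"
proof -
  obtain t' where t': "\<And>h h'. coeffs_related h h' \<Longrightarrow> poly h t = 0 \<Longrightarrow>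
      poly h' t + poly (pderiv h) t * t' = 0"
    using compatible_derivative by blast
  define H where "H = {(poly h t, poly h' t + poly (pderiv h) t * t') | h h'. coeffs_related h h'}"
  have G: "(a, a') \<in> H" if "(a, a') \<in> G" for a a'
    unfolding H_def using coeffs_related_monom[OF that, of 0]
    by (intro CollectI exI[of _ "monom a 0"] exI[of _ "monom a' 0"]) (simp add: monom_0)
  have "derivation_graph H"
  proof
    show "(-1, 0) \<in> H" using G minus_one by blast
  next
    fix a a' b b' assume "(a, a') \<in> H" "(b, b') \<in> H"
    then obtain g g' h h' where
      gh: "coeffs_related g g'" "a = poly g t" "a' = poly g' t + poly (pderiv g) t * t'"
        "coeffs_related h h'" "b = poly h t" "b' = poly h' t + poly (pderiv h) t * t'"
      unfolding H_def by blast
    show "(a + b, a' + b') \<in> H"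
      unfolding H_def using coeffs_related_add[OF gh(1,4)] gh
      by (intro CollectI exI[of _ "g + h"] exI[of _ "g' + h'"])
         (simp add: pderiv_add algebra_simps)
    show "(a * b, a' * b + a * b') \<in> H"
      unfolding H_def using coeffs_related_mult[OF gh(1,4)] gh
      by (intro CollectI exI[of _ "g * h"] exI[of _ "g' * h + g * h'"])
         (simp add: pderiv_mult algebra_simps)
  next
    fix b assume "(0, b) \<in> H"
    then show "b = 0" unfolding H_def using t' by auto
  qed
  moreover have "(t, t') \<in> H"
    unfolding H_def using coeffs_related_monom[OF one, of 1]
    by (intro CollectI exI[of _ "monom 1 1"] exI[of _ "0"]) (simp add: pderiv_monom poly_monom)
  ultimately show ?thesis using G by auto
qed

lemma adjoin_finite:
  assumes "finite T"
  shows "\<exists>H. derivation_graph H \<and> G \<subseteq> H \<and> T \<subseteq> Domain H"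
  using assms
proof (induction T rule: finite_induct)
  case empty
  show ?case using derivation_graph_axioms by blast
next
  case (insert t T)
  then obtain H where H: "derivation_graph H" "G \<subseteq> H" "T \<subseteq> Domain H" by blast
  obtain K t' where "derivation_graph K" "H \<subseteq> K" "(t, t') \<in> K"
    using derivation_graph.adjoin[OF H(1)] by blast
  then show ?case using H by (intro exI[of _ K]) blast
qed

end

text \<open>The value \<open>f x\<close> is sent to the derivative of \<open>f\<close> at
  \<open>x\<close> in direction \<open>v\<close>; this is well defined because the value at a
  generic point determines \<open>f\<close>.\<close>

lemma directional_derivation:
  assumes "algebraically_independent x I"
  shows "\<exists>G. derivation_graph G \<and> (\<forall>i\<in>I. (x i, v i) \<in> G)"
proof -
  define D where "D = (\<lambda>f b. ((\<lambda>s. f (\<lambda>i. x i + s * v i)) has_real_derivative b) (at 0))"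
  define G where "G = {(f x, b) | f b. f \<in> rat_poly_fun I \<and> D f b}"
  have "derivation_graph G"
  proof
    show "(-1, 0) \<in> G" unfolding G_def D_def using rat_poly_fun_of_int[of "-1" I]
      by (intro CollectI exI[of _ "\<lambda>_. -1"] exI[of _ 0]) auto
  next
    fix a a' b b' assume "(a, a') \<in> G" "(b, b') \<in> G"
    then obtain f g where fg: "f \<in> rat_poly_fun I" "D f a'" "a = f x"
      "g \<in> rat_poly_fun I" "D g b'" "b = g x" unfolding G_def by blast
    have "D (\<lambda>x. f x + g x) (a' + b')"
      using fg unfolding D_def by (intro DERIV_add)
    then show "(a + b, a' + b') \<in> G" unfolding G_def using fg rat_poly_fun.add
      by (intro CollectI exI[of _ "\<lambda>x. f x + g x"] exI[of _ "a' + b'"]) auto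
    have "D (\<lambda>x. f x * g x) (a' * b + a * b')"
      using DERIV_mult[OF fg(2,5)[unfolded D_def]] fg(3,6) unfolding D_def by (simp add: algebra_simps)
    then show "(a * b, a' * b + a * b') \<in> G" unfolding G_def using fg rat_poly_fun.mult
      by (intro CollectI exI[of _ "\<lambda>x. f x * g x"] exI[of _ "a' * b + a * b'"]) auto
  next
    fix b assume "(0, b) \<in> G"
    then obtain f where f: "f \<in> rat_poly_fun I" "D f b" "f x = 0" unfolding G_def by auto
    have "f y = 0" for y using rat_poly_fun_vanishes[OF assms f(1,3)] .
    then have "D f 0" unfolding D_def by simp
    then show "b = 0" using f(2) DERIV_unique unfolding D_def by blast
  qed
  moreover have "(x i, v i) \<in> G" if "i \<in> I" for i
  proof -
    have "D (\<lambda>x. x i) (v i)" unfolding D_def by (auto intro!: derivative_eq_intros)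
    then show ?thesis unfolding G_def using rat_poly_fun.var[OF that]
      by (intro CollectI exI[of _ "\<lambda>x. x i"] exI[of _ "v i"]) simp
  qed
  ultimately show ?thesis by blast
qed

section \<open>Stresses of frameworks\<close>

text \<open>For an edge \<open>{a, b}\<close> this is \<open>(x a - x b) * (y a - y b)\<close>; the formula avoids choosing an
  order of the endpoints.\<close>

definition edge_prod :: "('a \<Rightarrow> real) \<Rightarrow> ('a \<Rightarrow> real) \<Rightarrow> 'a set \<Rightarrow> real" where
  "edge_prod x y e = (\<Sum>w\<in>e. x w * (\<Sum>z\<in>e - {w}. y w - y z))"

lemma edge_prod_pair: "edge_prod x y {a, b} = (x a - x b) * (y a - y b)"
proof (cases "a = b")
  case False
  then have "{a, b} - {a} = {b}" "{a, b} - {b} = {a}" by auto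
  then show ?thesis using False by (simp add: edge_prod_def algebra_simps)
qed (simp add: edge_prod_def)

lemma edge_prod_commute: "card e = 2 \<Longrightarrow> edge_prod x y e = edge_prod y x e"
  by (auto simp: card_2_iff edge_prod_pair)

lemma edge_prod_zero_left: "edge_prod (\<lambda>_. 0) y e = 0"
  by (simp add: edge_prod_def)

lemma edge_prod_add_scale_left:
  "edge_prod (\<lambda>w. x w + s * z w) y e = edge_prod x y e + s * edge_prod z y e"
  by (simp add: edge_prod_def distrib_right sum.distrib sum_distrib_left mult.assoc)

lemma sum_mult_rigidity_matrix:
  assumes "finite V" "e \<subseteq> V"
  shows "(\<Sum>w\<in>V. x w * rigidity_matrix p e (w, k)) = edge_prod x (\<lambda>w. p w k) e"
proof -
  have "(\<Sum>w\<in>V. x w * rigidity_matrix p e (w, k)) = (\<Sum>w\<in>e. x w * rigidity_matrix p e (w, k))"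
    using assms by (intro sum.mono_neutral_right) (auto simp: rigidity_matrix_def)
  also have "\<dots> = edge_prod x (\<lambda>w. p w k) e"
    unfolding edge_prod_def by (rule sum.cong) (auto simp: rigidity_matrix_def)
  finally show ?thesis .
qed

text \<open>The sum on the right is the bilinear form of the stress matrix. A stress is thus a
  weighting whose stress matrix annihilates every coordinate vector of \<open>p\<close>.\<close>

lemma row_relation_rigidity_matrix_iff:
  assumes "finite V" "\<And>e. e \<in> F \<Longrightarrow> e \<subseteq> V"
  shows "row_relation (rigidity_matrix p) (V \<times> {..<d}) F \<omega> \<longleftrightarrow>
    (\<forall>k<d. \<forall>x. (\<Sum>e\<in>F. \<omega> e * edge_prod x (\<lambda>w. p w k) e) = 0)"
proof -
  have eq: "(\<Sum>e\<in>F. \<omega> e * edge_prod x (\<lambda>w. p w k) e) =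
      (\<Sum>w\<in>V. x w * (\<Sum>e\<in>F. \<omega> e * rigidity_matrix p e (w, k)))" for x k
  proof -
    have "(\<Sum>e\<in>F. \<omega> e * edge_prod x (\<lambda>w. p w k) e) =
        (\<Sum>e\<in>F. \<Sum>w\<in>V. \<omega> e * (x w * rigidity_matrix p e (w, k)))"
    proof (rule sum.cong)
      fix e assume "e \<in> F"
      from sum_mult_rigidity_matrix[OF assms(1) assms(2)[OF this], of x p k]
      show "\<omega> e * edge_prod x (\<lambda>w. p w k) e = (\<Sum>w\<in>V. \<omega> e * (x w * rigidity_matrix p e (w, k)))"
        by (simp only: sum_distrib_left[symmetric])
    qed simp
    also have "\<dots> = (\<Sum>w\<in>V. \<Sum>e\<in>F. \<omega> e * (x w * rigidity_matrix p e (w, k)))"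
      by (rule sum.swap)
    finally show ?thesis by (simp add: sum_distrib_left mult.left_commute)
  qed
  show ?thesis
  proof
    assume "row_relation (rigidity_matrix p) (V \<times> {..<d}) F \<omega>"
    then show "\<forall>k<d. \<forall>x. (\<Sum>e\<in>F. \<omega> e * edge_prod x (\<lambda>w. p w k) e) = 0"
      unfolding eq by (auto simp: row_relation_def)
  next
    assume R: "\<forall>k<d. \<forall>x. (\<Sum>e\<in>F. \<omega> e * edge_prod x (\<lambda>w. p w k) e) = 0"
    have "(\<Sum>e\<in>F. \<omega> e * rigidity_matrix p e (v, k)) = 0" if "v \<in> V" "k < d" for v k
    proof -
      define r where "r = (\<lambda>w. \<Sum>e\<in>F. \<omega> e * rigidity_matrix p e (w, k))"
      have "0 = (\<Sum>w\<in>V. (if w = v then 1 else 0) * r w)"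
        using R[unfolded eq, rule_format, OF that(2), of "\<lambda>w. if w = v then 1 else 0"]
        unfolding r_def by (rule sym)
      also have "\<dots> = (\<Sum>w\<in>V. if w = v then r w else 0)" by (rule sum.cong) auto
      also have "\<dots> = r v" using that(1) assms(1) by simp
      finally show ?thesis by (simp add: r_def)
    qed
    then show "row_relation (rigidity_matrix p) (V \<times> {..<d}) F \<omega>"
      by (auto simp: row_relation_def)
  qed
qed

lemma pdist_squared: "(pdist d p a b)\<^sup>2 = (\<Sum>k<d. edge_prod (\<lambda>w. p w k) (\<lambda>w. p w k) {a, b})"
  by (simp add: pdist_def L2_set_def edge_prod_pair sum_nonneg power2_eq_square)

lemma pdist_commute: "pdist d p a b = pdist d p b a"
  by (simp add: pdist_def L2_set_def power2_commute)

lemma rigidity_matrix_rat_poly_fun: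
  assumes "e \<subseteq> V" "c \<in> V \<times> {..<d}"
  shows "(\<lambda>y. rigidity_matrix (curry y) e c) \<in> rat_poly_fun (V \<times> {..<d})"
proof -
  obtain w k where c: "c = (w, k)" "w \<in> V" "k < d" using assms(2) by auto
  show ?thesis
  proof (cases "w \<in> e")
    case True
    have "(\<lambda>y. \<Sum>z\<in>e - {w}. y (w, k) - y (z, k)) \<in> rat_poly_fun (V \<times> {..<d})"
      using assms(1) c by (intro rat_poly_fun_sum rat_poly_fun_diff rat_poly_fun.var) auto
    then show ?thesis using True c by (simp add: rigidity_matrix_def)
  next
    case False
    then show ?thesis using rat_poly_fun_of_int[of 0] c by (simp add: rigidity_matrix_def)
  qed
qed

lemma (in derivation_graph) edge_prod_self:
  assumes "card e = 2" "\<And>w. w \<in> e \<Longrightarrow> (x w, x' w) \<in> G"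
  shows "(edge_prod x x e, 2 * edge_prod x' x e) \<in> G"
proof -
  obtain a b where e: "e = {a, b}" using assms(1) by (auto simp: card_2_iff)
  then have "(x a - x b, x' a - x' b) \<in> G" using assms(2) by (intro diff) auto
  from mult[OF this this] show ?thesis unfolding e edge_prod_pair by (simp add: algebra_simps)
qed

section \<open>Common stresses of a generic framework and an equivalent one\<close>

context
  fixes V :: "'a set" and d :: nat and p q :: "'a placement"
  assumes finV: "finite V" and gen: "generic d V p"
begin

text \<open>Differentiating \<open>\<parallel>p a - p b\<parallel>\<^sup>2 = \<parallel>q a - q b\<parallel>\<^sup>2\<close> along a derivation that prescribes the
  derivatives of the coordinates of \<open>p\<close> shows that the image of the rigidity matrix of \<open>p\<close> is
  contained in that of \<open>q\<close>.\<close>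

lemma stress_of_generic_if_stress:
  assumes F: "\<And>e. e \<in> F \<Longrightarrow> e \<subseteq> V \<and> card e = 2"
    and equiv: "equivalent_frameworks d F p q"
    and stress: "row_relation (rigidity_matrix q) (V \<times> {..<d}) F \<omega>"
  shows "row_relation (rigidity_matrix p) (V \<times> {..<d}) F \<omega>"
proof -
  have "(\<Sum>e\<in>F. \<omega> e * edge_prod x (\<lambda>w. p w j) e) = 0" if "j < d" for j x
  proof -
    \<comment> \<open>An arbitrary velocity \<open>x\<close> in coordinate \<open>j\<close> and zero
      in all others tests the columns of coordinate \<open>j\<close>.\<close>
    define p' where "p' = (\<lambda>w k. if k = j then x w else 0)"
    obtain G where G: "derivation_graph G" "\<And>w k. w \<in> V \<Longrightarrow> k < d \<Longrightarrow> (p w k, p' w k) \<in> G"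
      using directional_derivation[of "case_prod p" "V \<times> {..<d}" "case_prod p'"] gen
      unfolding generic_def by auto
    obtain H where H: "derivation_graph H" "G \<subseteq> H" "case_prod q ` (V \<times> {..<d}) \<subseteq> Domain H"
      using derivation_graph.adjoin_finite[OF G(1), of "case_prod q ` (V \<times> {..<d})"] finV by auto
    interpret H: derivation_graph H by fact
    have "\<forall>wk\<in>V \<times> {..<d}. \<exists>b. (case_prod q wk, b) \<in> H" using H(3) by blast
    from bchoice[OF this] obtain r where r: "\<forall>wk\<in>V \<times> {..<d}. (case_prod q wk, r wk) \<in> H" ..
    define q' where "q' = curry r"
    have pq': "(p w k, p' w k) \<in> H" "(q w k, q' w k) \<in> H" if "w \<in> V" "k < d" for w k
      using r that G(2)[OF that] H(2) by (auto simp: q'_def)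
    \<comment> \<open>The rates of change of the edge lengths under \<open>p'\<close> are also those
      of \<open>q\<close> under \<open>q'\<close>, so every stress of \<open>q\<close> annihilates
      them.\<close>
    have edge: "edge_prod x (\<lambda>w. p w j) e = (\<Sum>k<d. edge_prod (\<lambda>w. q' w k) (\<lambda>w. q w k) e)"
      if e: "e \<in> F" for e
    proof -
      let ?P = "\<Sum>k<d. edge_prod (\<lambda>w. p w k) (\<lambda>w. p w k) e"
      let ?Q = "\<Sum>k<d. edge_prod (\<lambda>w. q w k) (\<lambda>w. q w k) e"
      obtain a b where ab: "e = {a, b}" using F[OF e] by (auto simp: card_2_iff)
      have "?P = ?Q" using equiv e unfolding ab equivalent_frameworks_def
        by (simp flip: pdist_squared)
      moreover have "(?P, \<Sum>k<d. 2 * edge_prod (\<lambda>w. p' w k) (\<lambda>w. p w k) e) \<in> H"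
        using F[OF e] pq' by (intro H.sum H.edge_prod_self) auto
      moreover have "(?Q, \<Sum>k<d. 2 * edge_prod (\<lambda>w. q' w k) (\<lambda>w. q w k) e) \<in> H"
        using F[OF e] pq' by (intro H.sum H.edge_prod_self) auto
      ultimately have "(\<Sum>k<d. 2 * edge_prod (\<lambda>w. p' w k) (\<lambda>w. p w k) e) =
          (\<Sum>k<d. 2 * edge_prod (\<lambda>w. q' w k) (\<lambda>w. q w k) e)"
        using H.unique[of ?Q] by simp
      moreover have "(\<Sum>k<d. edge_prod (\<lambda>w. p' w k) (\<lambda>w. p w k) e) = edge_prod x (\<lambda>w. p w j) e"
        using \<open>j < d\<close> by (subst sum.remove[of _ j])
          (auto simp: p'_def edge_prod_zero_left intro!: sum.neutral)
      ultimately show ?thesis by (simp flip: sum_distrib_left)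
    qed
    have "(\<Sum>e\<in>F. \<omega> e * edge_prod x (\<lambda>w. p w j) e) =
        (\<Sum>e\<in>F. \<Sum>k<d. \<omega> e * edge_prod (\<lambda>w. q' w k) (\<lambda>w. q w k) e)"
      by (intro sum.cong) (auto simp: edge sum_distrib_left)
    also have "\<dots> = (\<Sum>k<d. \<Sum>e\<in>F. \<omega> e * edge_prod (\<lambda>w. q' w k) (\<lambda>w. q w k) e)"
      by (rule sum.swap)
    also have "\<dots> = 0"
      using stress F by (subst (asm) row_relation_rigidity_matrix_iff[OF finV]) auto
    finally show ?thesis .
  qed
  then show ?thesis using F by (subst row_relation_rigidity_matrix_iff[OF finV]) auto
qed

text \<open>This replaces a comparison of dimensions. If \<open>p\<close> has a nonzero stress, so
  does \<open>q\<close>, and that stress \<open>b\<close> is also one of \<open>p\<close>.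
  Subtracting a multiple of \<open>b\<close> from \<open>\<omega>\<close> frees an edge
  \<open>h\<close>, and induction applies to \<open>F - {h}\<close>.\<close>

lemma stress_if_stress_of_generic:
  assumes "finite F" "\<And>e. e \<in> F \<Longrightarrow> e \<subseteq> V \<and> card e = 2"
    and "equivalent_frameworks d F p q"
    and "row_relation (rigidity_matrix p) (V \<times> {..<d}) F \<omega>"
  shows "row_relation (rigidity_matrix q) (V \<times> {..<d}) F \<omega>"
  using assms
proof (induction F arbitrary: \<omega> rule: finite_psubset_induct)
  case (psubset F)
  show ?case
  proof (cases "\<exists>g\<in>F. \<omega> g \<noteq> 0")
    case False
    then show ?thesis by (simp add: row_relation_def)
  next
    case True
    then obtain g where g: "g \<in> F" "\<omega> g \<noteq> 0" by blast
    \<comment> \<open>The transfer from the generic \<open>p\<close> yields some nonzero stress of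
      \<open>q\<close>, possibly different from \<open>\<omega>\<close>.\<close>
    have "\<exists>b. row_relation (rigidity_matrix (curry (case_prod q))) (V \<times> {..<d}) F b \<and>
        (\<exists>e\<in>F. b e \<noteq> 0)"
      using gen finV psubset.hyps psubset.prems g unfolding generic_def
      by (intro row_relation_transfer[where x = "case_prod p" and I = "V \<times> {..<d}" and a = \<omega>]
          rigidity_matrix_rat_poly_fun) auto
    then obtain b h where b: "row_relation (rigidity_matrix q) (V \<times> {..<d}) F b" "h \<in> F" "b h \<noteq> 0"
      by auto
    define t where "t = \<omega> h / b h"
    define \<tau> where "\<tau> = (\<lambda>e. \<omega> e - t * b e)"
    have "\<tau> h = 0" using b(3) by (simp add: \<tau>_def t_def)
    note delete = row_relation_delete[of F \<tau>, OF psubset.hyps this]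
    have "row_relation (rigidity_matrix p) (V \<times> {..<d}) F \<tau>"
      unfolding \<tau>_def
      by (rule row_relation_diff_scale[OF psubset.prems(3)
            stress_of_generic_if_stress[OF psubset.prems(1,2) b(1)]])
    then have "row_relation (rigidity_matrix p) (V \<times> {..<d}) (F - {h}) \<tau>"
      by (rule delete[THEN iffD1])
    then have "row_relation (rigidity_matrix q) (V \<times> {..<d}) (F - {h}) \<tau>"
      using b(2) psubset.prems(1,2)
      by (intro psubset.IH) (auto simp: equivalent_frameworks_def)
    then have "row_relation (rigidity_matrix q) (V \<times> {..<d}) F \<tau>"
      by (rule delete[THEN iffD2])
    from row_relation_add_scale[OF this b(1), of t] show ?thesis by (simp add: \<tau>_def)
  qed
qed

end

section \<open>Lifting a generic placement by one coordinate\<close>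

lemma rat_approximation: "\<exists>r :: nat \<Rightarrow> rat. (\<lambda>n. real_of_rat (r n)) \<longlonglongrightarrow> x"
proof -
  have "\<exists>q. x < of_rat q \<and> of_rat q < x + inverse (real (Suc n))" for n
    by (rule of_rat_dense) simp
  then have "\<forall>n. \<exists>q. x < of_rat q \<and> of_rat q < x + inverse (real (Suc n))" by blast
  from choice[OF this] obtain r where
    r: "\<And>n. x < of_rat (r n) \<and> of_rat (r n) < x + inverse (real (Suc n))" by blast
  have "(\<lambda>n. real_of_rat (r n)) \<longlonglongrightarrow> x"
    by (rule tendsto_sandwich[OF _ _ tendsto_const LIMSEQ_inverse_real_of_nat_add])
       (use r in \<open>simp_all add: less_imp_le\<close>)
  then show ?thesis by blast
qed

definition lift_placement :: "nat \<Rightarrow> 'a placement \<Rightarrow> ('a \<Rightarrow> real) \<Rightarrow> 'a \<times> nat \<Rightarrow> real" where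
  "lift_placement d p x = (\<lambda>(w, k). if k < d then p w k else x w)"

text \<open>For rational \<open>x\<close> the value at the lift of \<open>p\<close> is a rational polynomial in the coordinates of
  \<open>p\<close>, so if it is zero it vanishes identically; the last coordinate of \<open>p\<^sub>0\<close> is then reached by
  continuity.\<close>

lemma nonzero_at_some_lift:
  assumes gen: "generic d V p"
    and f: "f \<in> rat_poly_fun (V \<times> {..<d + 1})" "f (case_prod p\<^sub>0) \<noteq> 0"
  shows "\<exists>x. f (lift_placement d p x) \<noteq> 0"
proof (rule ccontr)
  assume "\<nexists>x. f (lift_placement d p x) \<noteq> 0"
  then have 0: "f (lift_placement d p x) = 0" for x by blast
  have rat0: "f (lift_placement d p' (\<lambda>w. of_rat (r w))) = 0" for r p'
  proof -
    define h where "h = (\<lambda>z. f (lift_placement d (curry z) (\<lambda>w. of_rat (r w))))"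
    have "h \<in> rat_poly_fun (V \<times> {..<d})"
      unfolding h_def
    proof (rule rat_poly_fun_subst[OF f(1)])
      fix c assume "c \<in> V \<times> {..<d + 1}"
      then obtain w k where "c = (w, k)" "w \<in> V" by auto
      then show "(\<lambda>z. lift_placement d (curry z) (\<lambda>w. of_rat (r w)) c) \<in> rat_poly_fun (V \<times> {..<d})"
        using rat_poly_fun.var[of "(w, k)" "V \<times> {..<d}"] rat_poly_fun.const[of "r w"]
        by (cases "k < d") (simp_all add: lift_placement_def)
    qed
    moreover have "h (case_prod p) = 0" using 0 by (simp add: h_def)
    ultimately have "h (case_prod p') = 0"
      using rat_poly_fun_vanishes gen unfolding generic_def by blast
    then show ?thesis by (simp add: h_def)
  qed
  have "\<forall>w. \<exists>r :: nat \<Rightarrow> rat. (\<lambda>n. real_of_rat (r n)) \<longlonglongrightarrow> p\<^sub>0 w d"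
    using rat_approximation by blast
  from choice[OF this] obtain r :: "_ \<Rightarrow> nat \<Rightarrow> rat" where
    r: "\<And>w. (\<lambda>n. real_of_rat (r w n)) \<longlonglongrightarrow> p\<^sub>0 w d" by blast
  have "(\<lambda>n. f (lift_placement d p\<^sub>0 (\<lambda>w. of_rat (r w n)))) \<longlonglongrightarrow> f (case_prod p\<^sub>0)"
  proof (rule rat_poly_fun_tendsto[OF f(1)])
    fix c assume "c \<in> V \<times> {..<d + 1}"
    then obtain w k where "c = (w, k)" "k \<le> d" by auto
    then show "(\<lambda>n. lift_placement d p\<^sub>0 (\<lambda>w. of_rat (r w n)) c) \<longlonglongrightarrow> case_prod p\<^sub>0 c"
      using r by (cases "k < d") (auto simp: lift_placement_def)
  qed
  then show False using f(2) by (simp add: rat0 LIMSEQ_const_iff)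
qed

section \<open>Edges in circuits have determined length\<close>

text \<open>The framework \<open>p\<^sub>0\<close> and its stress \<open>a\<close> supply polynomial
  stresses whose coefficient at the edge is not identically zero; at lifts of \<open>p\<close> they
  specialise to stresses of \<open>p\<close>.\<close>

lemma edge_length_determined:
  assumes "finite V" "finite E" "\<And>e. e \<in> E \<Longrightarrow> e \<subseteq> V \<and> card e = 2"
    and gen\<^sub>0: "generic (d + 1) V p\<^sub>0"
    and "row_relation (rigidity_matrix p\<^sub>0) (V \<times> {..<d + 1}) E a" "{u, v} \<in> E" "a {u, v} \<noteq> 0"
    and gen: "generic d V p"
    and equiv: "equivalent_frameworks d (E - {{u, v}}) p q"
  shows "pdist d p u v = pdist d q u v"
proof -
  define g where "g = {u, v}"
  have g: "g \<in> E" "a g \<noteq> 0" using assms(6,7) by (auto simp: g_def)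
  have rel_iff: "row_relation (rigidity_matrix r) (V \<times> {..<n}) E \<omega> \<longleftrightarrow>
      (\<forall>k<n. \<forall>x. (\<Sum>e\<in>E. \<omega> e * edge_prod x (\<lambda>w. r w k) e) = 0)" for r n \<omega>
    using assms(1,3) by (intro row_relation_rigidity_matrix_iff) auto
  have "\<exists>P. (\<forall>e\<in>E. P e \<in> rat_poly_fun (V \<times> {..<d + 1})) \<and> P g (case_prod p\<^sub>0) \<noteq> 0 \<and>
      (\<forall>y. row_relation (rigidity_matrix (curry y)) (V \<times> {..<d + 1}) E (\<lambda>e. P e y))"
    using assms(1-5) g unfolding generic_def
    by (intro polynomial_row_relation[where a = a] rigidity_matrix_rat_poly_fun) auto
  then obtain P where P: "P g \<in> rat_poly_fun (V \<times> {..<d + 1})" "P g (case_prod p\<^sub>0) \<noteq> 0"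
      "\<And>y. row_relation (rigidity_matrix (curry y)) (V \<times> {..<d + 1}) E (\<lambda>e. P e y)"
    using g(1) by blast
  define y where "y = lift_placement d p"
  \<comment> \<open>The first \<open>d\<close> coordinates of the lift give a stress of
    \<open>p\<close>; the last one says that its stress matrix also annihilates
    \<open>x\<close>.\<close>
  have stress: "row_relation (rigidity_matrix p) (V \<times> {..<d}) E (\<lambda>e. P e (y x))"
    and last: "(\<Sum>e\<in>E. P e (y x) * edge_prod z x e) = 0" for x z
  proof -
    have *: "(\<Sum>e\<in>E. P e (y x) * edge_prod z (\<lambda>w. y x (w, k)) e) = 0" if "k < d + 1" for k z
      using P(3)[of "y x", unfolded rel_iff, rule_format, OF that, of z] by simp
    show "row_relation (rigidity_matrix p) (V \<times> {..<d}) E (\<lambda>e. P e (y x))"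
      unfolding rel_iff
    proof (intro allI impI)
      fix k z assume "k < d"
      then have "(\<lambda>w. y x (w, k)) = (\<lambda>w. p w k)" by (simp add: y_def lift_placement_def)
      then show "(\<Sum>e\<in>E. P e (y x) * edge_prod z (\<lambda>w. p w k) e) = 0"
        using *[of k z] \<open>k < d\<close> by simp
    qed
    show "(\<Sum>e\<in>E. P e (y x) * edge_prod z x e) = 0"
      using *[of d] by (simp add: y_def lift_placement_def)
  qed
  obtain x\<^sub>0 where x0: "P g (y x\<^sub>0) \<noteq> 0"
    using nonzero_at_some_lift[OF gen P(1,2)] unfolding y_def by blast
  define \<omega> where "\<omega> = (\<lambda>e. inverse (P g (y x\<^sub>0)) * P e (y x\<^sub>0))"
  have \<omega>g: "\<omega> g = 1" using x0 by (simp add: \<omega>_def)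
  have \<omega>: "row_relation (rigidity_matrix p) (V \<times> {..<d}) E \<omega>"
    unfolding \<omega>_def by (rule row_relation_scale[OF stress])
  have orth: "(\<Sum>e\<in>E. \<omega> e * edge_prod x (\<lambda>w. q w k) e) = 0" if "k < d" "P g (y x) \<noteq> 0" for x k
  proof -
    define t where "t = inverse (P g (y x))"
    \<comment> \<open>Both scaled stresses have coefficient 1 at \<open>g\<close>, so their
      difference lives on \<open>E - {g}\<close> and is a stress of \<open>q\<close> as
      well.\<close>
    define \<tau> where "\<tau> = (\<lambda>e. \<omega> e - t * P e (y x))"
    have "\<tau> g = 0" using that \<omega>g by (simp add: \<tau>_def t_def)
    note delete = row_relation_delete[of E \<tau>, OF assms(2) this]
    have "row_relation (rigidity_matrix p) (V \<times> {..<d}) E \<tau>"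
      unfolding \<tau>_def by (rule row_relation_diff_scale[OF \<omega> stress])
    then have "row_relation (rigidity_matrix p) (V \<times> {..<d}) (E - {g}) \<tau>"
      by (rule delete[THEN iffD1])
    then have "row_relation (rigidity_matrix q) (V \<times> {..<d}) (E - {g}) \<tau>"
    proof (rule stress_if_stress_of_generic[OF assms(1) gen, rotated -1])
      show "equivalent_frameworks d (E - {g}) p q" using equiv by (simp add: g_def)
    qed (use assms(2,3) in auto)
    then have "row_relation (rigidity_matrix q) (V \<times> {..<d}) E \<tau>"
      by (rule delete[THEN iffD2])
    then have 1: "(\<Sum>e\<in>E. \<tau> e * edge_prod x (\<lambda>w. q w k) e) = 0"
      unfolding rel_iff using that(1) by blast
    \<comment> \<open>By symmetry the stress matrix can act on \<open>x\<close>, which it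
      annihilates, instead of on a coordinate of \<open>q\<close>.\<close>
    have "(\<Sum>e\<in>E. P e (y x) * edge_prod x (\<lambda>w. q w k) e) =
        (\<Sum>e\<in>E. P e (y x) * edge_prod (\<lambda>w. q w k) x e)"
    proof (rule sum.cong)
      fix e assume "e \<in> E"
      then have "card e = 2" using assms(3) by blast
      then show "P e (y x) * edge_prod x (\<lambda>w. q w k) e = P e (y x) * edge_prod (\<lambda>w. q w k) x e"
        by (simp only: edge_prod_commute[of e x "\<lambda>w. q w k"])
    qed simp
    also have "\<dots> = 0" by (rule last)
    finally have 2: "(\<Sum>e\<in>E. P e (y x) * edge_prod x (\<lambda>w. q w k) e) = 0" .
    have "(\<Sum>e\<in>E. \<omega> e * edge_prod x (\<lambda>w. q w k) e) =
        (\<Sum>e\<in>E. \<tau> e * edge_prod x (\<lambda>w. q w k) e) +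
        t * (\<Sum>e\<in>E. P e (y x) * edge_prod x (\<lambda>w. q w k) e)"
      unfolding \<tau>_def sum_distrib_left sum.distrib[symmetric]
      by (rule sum.cong) (simp_all add: algebra_simps)
    then show ?thesis unfolding 1 2 by simp
  qed
  have q0: "(\<Sum>e\<in>E. \<omega> e * edge_prod (\<lambda>w. q w k) (\<lambda>w. q w k) e) = 0" if k: "k < d" for k
  proof -
    \<comment> \<open>The line leads from coordinate \<open>k\<close> of \<open>q\<close>, where
      \<open>P g\<close> may vanish at the lift, to \<open>x\<^sub>0\<close>, where it does not. The
      form is affine along it, with constant term \<open>A\<close>.\<close>
    define l where "l = (\<lambda>s w. q w k + s * (x\<^sub>0 w - q w k))"
    define A where "A = (\<Sum>e\<in>E. \<omega> e * edge_prod (\<lambda>w. q w k) (\<lambda>w. q w k) e)"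
    define B where "B = (\<Sum>e\<in>E. \<omega> e * edge_prod (\<lambda>w. x\<^sub>0 w - q w k) (\<lambda>w. q w k) e)"
    have "(\<Sum>e\<in>E. \<omega> e * edge_prod (l s) (\<lambda>w. q w k) e) = A + s * B" for s
    proof -
      have "A + s * B = (\<Sum>e\<in>E. \<omega> e * edge_prod (\<lambda>w. q w k) (\<lambda>w. q w k) e +
          s * (\<omega> e * edge_prod (\<lambda>w. x\<^sub>0 w - q w k) (\<lambda>w. q w k) e))"
        unfolding A_def B_def sum_distrib_left sum.distrib ..
      also have "\<dots> = (\<Sum>e\<in>E. \<omega> e * edge_prod (l s) (\<lambda>w. q w k) e)"
        unfolding l_def edge_prod_add_scale_left by (rule sum.cong) (simp_all add: algebra_simps)
      finally show ?thesis ..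
    qed
    then have line: "P g (y (l s)) \<noteq> 0 \<Longrightarrow> A + s * B = 0" for s using orth[OF k, of "l s"] by simp
    have "y (l s) = (\<lambda>i. y (\<lambda>w. q w k) i + s * (y x\<^sub>0 i - y (\<lambda>w. q w k) i))" for s
      by (auto simp: y_def lift_placement_def l_def)
    then obtain \<pi> :: "real poly" where \<pi>: "\<And>s. P g (y (l s)) = poly \<pi> s"
      using rat_poly_fun_along_line[OF P(1), of "y (\<lambda>w. q w k)"
          "\<lambda>i. y x\<^sub>0 i - y (\<lambda>w. q w k) i"] by auto
    have "l 1 = x\<^sub>0" by (simp add: l_def)
    then have "\<pi> \<noteq> 0" using \<pi>[of 1] x0 by auto
    \<comment> \<open>Wherever \<open>\<pi>\<close> is nonzero the affine factor vanishes, so the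
      product is zero; since \<open>\<pi>\<close> is not the zero polynomial,
      \<open>A = 0\<close>.\<close>
    moreover have "poly (\<pi> * [:A, B:]) s = 0" for s
      using line[of s] \<pi>[of s] by (cases "poly \<pi> s = 0") (simp_all only: poly_mult, simp_all)
    then have "\<pi> * [:A, B:] = 0" using poly_all_0_iff_0 by blast
    ultimately have "[:A, B:] = 0" using mult_eq_0_iff[of \<pi> "[:A, B:]"] by blast
    then show ?thesis by (simp add: A_def)
  qed
  have p0: "(\<Sum>e\<in>E. \<omega> e * edge_prod (\<lambda>w. p w k) (\<lambda>w. p w k) e) = 0" if "k < d" for k
    using \<omega> that unfolding rel_iff by blast
  define L where "L = (\<lambda>(r :: 'a placement) e. \<Sum>k<d. edge_prod (\<lambda>w. r w k) (\<lambda>w. r w k) e)"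
  have energy: "(\<Sum>e\<in>E. \<omega> e * L r e) = 0" if "r \<in> {p, q}" for r
  proof -
    have "(\<Sum>e\<in>E. \<omega> e * L r e) = (\<Sum>k<d. \<Sum>e\<in>E. \<omega> e * edge_prod (\<lambda>w. r w k) (\<lambda>w. r w k) e)"
      unfolding L_def sum_distrib_left by (rule sum.swap)
    also have "\<dots> = 0" using that p0 q0 by (intro sum.neutral) auto
    finally show ?thesis .
  qed
  have "L p e = L q e" if e: "e \<in> E - {g}" for e
  proof -
    have "card e = 2" using assms(3) e by blast
    then obtain a b where "e = {a, b}" by (auto simp: card_2_iff)
    then show ?thesis using equiv e unfolding L_def equivalent_frameworks_def g_def
      by (auto simp flip: pdist_squared)
  qed
  then have "(\<Sum>e\<in>E - {g}. \<omega> e * L p e) = (\<Sum>e\<in>E - {g}. \<omega> e * L q e)" by simp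
  moreover have "L r g + (\<Sum>e\<in>E - {g}. \<omega> e * L r e) = 0" if "r \<in> {p, q}" for r
    using energy[OF that] sum.remove[OF assms(2) g(1), of "\<lambda>e. \<omega> e * L r e"] \<omega>g by simp
  from this[of p] this[of q] have "L p g + (\<Sum>e\<in>E - {g}. \<omega> e * L p e) = 0"
    "L q g + (\<Sum>e\<in>E - {g}. \<omega> e * L q e) = 0" by simp_all
  ultimately have "L p g = L q g" by linarith
  then have "(pdist d p u v)\<^sup>2 = (pdist d q u v)\<^sup>2" unfolding pdist_squared L_def g_def .
  then show ?thesis by (simp add: pdist_def L2_set_nonneg)
qed

theorem theorem1p4:
  fixes d :: nat and V :: "'a set" and E :: "'a set set"
  assumes "d \<ge> 1"
    and "simple_graph V E"
    and "minimally_globally_rigid d V E"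
  shows "rigidity_independent (d + 1) V E"
proof (rule ccontr)
  assume "\<not> rigidity_independent (d + 1) V E"
  then obtain p\<^sub>0 a g where p0: "generic (d + 1) V p\<^sub>0" "g \<in> E" "a g \<noteq> 0"
    "row_relation (rigidity_matrix p\<^sub>0) (V \<times> {..<d + 1}) E a"
    unfolding rigidity_independent_def rigidity_matroid_indep_def rows_independent_def
      row_relation_def by blast
  have E: "e \<subseteq> V \<and> card e = 2" if "e \<in> E" for e
    using assms(2) that unfolding simple_graph_def by auto
  have "finite V" using assms(2) by (simp add: simple_graph_def)
  moreover have "finite E"
    using \<open>finite V\<close> E by (intro finite_subset[of E "Pow V"]) auto
  moreover obtain u v where g: "g = {u, v}" using E[OF p0(2)] by (auto simp: card_2_iff)
  \<comment> \<open>Minimality is applied to the edge \<open>g\<close> on which the stress is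
    nonzero.\<close>
  moreover obtain p q where pq: "generic d V p" "equivalent_frameworks d (E - {g}) p q"
    "\<not> congruent_frameworks d V p q"
    using assms(3) p0(2) unfolding minimally_globally_rigid_def globally_rigid_def
      globally_rigid_framework_def by blast
  ultimately have "pdist d p u v = pdist d q u v"
    using E p0 by (intro edge_length_determined[of V E d p\<^sub>0 a]) auto
  then have "pdist d p a b = pdist d q a b" if "{a, b} = g" for a b
    using that unfolding g doubleton_eq_iff by (elim disjE conjE) (simp_all add: pdist_commute[of d _ v u])
  then have "equivalent_frameworks d E p q"
    using pq(2) unfolding equivalent_frameworks_def by (metis Diff_iff singletonD)
  then show False
    using assms(3) pq(1,3) unfolding minimally_globally_rigid_def globally_rigid_def
      globally_rigid_framework_def by blast
qed

end
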